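(* Let $k\ge 1$ be an integer. If $G$ is a graph of order $n$, then $L_k(G)\leq n+k-1-\Delta(G)$.
   Context: All graphs are finite, undirected, simple and nontrivial (at least two vertices). $\Delta(G)$ is the maximum degree and $N[v]=\{v\}\cup N(v)$ is the closed neighbourhood of $v$. For an integer $k\ge 1$, a set $B\subseteq V(G)$ is a $k$-limited packing if $|N[v]\cap B|\le k$ for every vertex $v$ of $G$; $L_k(G)$ is the maximum cardinality of a $k$-limited packing in $G$. *)

theory Defs
  imports "Graph_Theory.Digraph"
begin

text \<open>
  Finite undirected simple graphs are taken in the sense of the locale \<^locale>\<open>graph\<close>:
  finite loop-free digraphs without multiple arcs whose adjacency relation
  \<^const>\<open>arcs_ends\<close> is symmetric, so that an undirected edge is a pair of opposite arcs.
\<close>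

definition nbhd :: "('a, 'b) pre_digraph \<Rightarrow> 'a \<Rightarrow> 'a set" where
  "nbhd G v = {u. v \<rightarrow>\<^bsub>G\<^esub> u}"

definition closed_nbhd :: "('a, 'b) pre_digraph \<Rightarrow> 'a \<Rightarrow> 'a set" where
  "closed_nbhd G v = insert v (nbhd G v)"

definition degree :: "('a, 'b) pre_digraph \<Rightarrow> 'a \<Rightarrow> nat" where
  "degree G v = card (nbhd G v)"

definition max_degree :: "('a, 'b) pre_digraph \<Rightarrow> nat" where
  "max_degree G = Max (degree G ` verts G)"

definition limited_packing :: "nat \<Rightarrow> ('a, 'b) pre_digraph \<Rightarrow> 'a set \<Rightarrow> bool" where
  "limited_packing k G B \<longleftrightarrow>
     B \<subseteq> verts G \<and> (\<forall>v \<in> verts G. card (closed_nbhd G v \<inter> B) \<le> k)"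

text \<open>
  For finite \<open>G\<close> the maximum is over a finite set, which is nonempty because the
  empty set is a limited packing.
\<close>

definition limited_packing_number :: "nat \<Rightarrow> ('a, 'b) pre_digraph \<Rightarrow> nat" where
  "limited_packing_number k G = Max (card ` {B. limited_packing k G B})"

end

theory Submission
  imports Defs
begin

text \<open>Fix a vertex v of maximum degree and a maximum packing B. The closed neighbourhood N[v]
  has \<Delta>(G) + 1 elements and meets B in at most k of them, while N[v] and B together occupy at
  most n vertices. Inclusion-exclusion then gives |B| + \<Delta>(G) + 1 \<le> n + k. The count is
  \<open>limited_packing_card_le\<close>, valid at every vertex;
  \<open>obtain_max_limited_packing\<close> supplies B.\<close>

lemma (in wf_digraph) closed_nbhd_subset_verts:
  "v \<in> verts G \<Longrightarrow> closed_nbhd G v \<subseteq> verts G"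
  unfolding closed_nbhd_def nbhd_def using adj_in_verts(2) by blast

text \<open>Loop-freeness keeps v out of its own neighbourhood, so inserting it adds exactly one
  element; this is the source of the -1 in the final bound.\<close>

lemma (in digraph) card_closed_nbhd:
  assumes "v \<in> verts G"
  shows "card (closed_nbhd G v) = Suc (degree G v)"
proof -
  have "finite (nbhd G v)"
    using closed_nbhd_subset_verts[OF assms] finite_verts
    by (auto simp: closed_nbhd_def intro: finite_subset)
  moreover have "v \<notin> nbhd G v"
    using adj_not_same unfolding nbhd_def by blast
  ultimately show ?thesis
    by (simp add: closed_nbhd_def degree_def)
qed

text \<open>Inclusion-exclusion for B and N[v]. The additive form avoids truncated subtraction on
  the naturals.\<close>

lemma (in digraph) limited_packing_card_le:
  assumes B: "limited_packing k G B" and v: "v \<in> verts G"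
  shows "card B + Suc (degree G v) \<le> card (verts G) + k"
proof -
  let ?N = "closed_nbhd G v"
  have sub: "B \<subseteq> verts G" "?N \<subseteq> verts G" and le_k: "card (?N \<inter> B) \<le> k"
    using B v closed_nbhd_subset_verts unfolding limited_packing_def by auto
  then have fin: "finite B" "finite ?N"
    using finite_verts by (auto intro: finite_subset)
  have "card B + card ?N = card (?N \<union> B) + card (?N \<inter> B)"
    using card_Un_Int[OF fin(2,1)] by simp
  moreover have "card (?N \<union> B) \<le> card (verts G)"
    using sub finite_verts by (intro card_mono) auto
  ultimately show ?thesis
    using le_k card_closed_nbhd[OF v] by simp
qed

text \<open>\<open>Max\<close> is attained because packings are subsets of the finite vertex set and
  the empty set is one of them.\<close>

lemma (in fin_digraph) obtain_max_limited_packing: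
  obtains B where "limited_packing k G B" "card B = limited_packing_number k G"
proof -
  let ?P = "{B. limited_packing k G B}"
  have "finite ?P"
    by (rule finite_subset[of _ "Pow (verts G)"]) (auto simp: limited_packing_def)
  moreover have "{} \<in> ?P"
    by (simp add: limited_packing_def)
  ultimately have "limited_packing_number k G \<in> card ` ?P"
    unfolding limited_packing_number_def by (intro Max_in) auto
  then show thesis
    using that by auto
qed

theorem theorem3p9:
  fixes G :: "('a, 'b) pre_digraph" and k n :: nat
  assumes "graph G"
    and "card (verts G) = n"
    and "n \<ge> 2"
    and "k \<ge> 1"
  shows "int (limited_packing_number k G) \<le> int n + int k - 1 - int (max_degree G)"
proof -
  interpret graph G by fact
  \<comment> \<open>A nonempty vertex set is what guarantees that the \<open>Max\<close> in
    \<open>max_degree\<close> is the degree of an actual vertex.\<close>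
  have "verts G \<noteq> {}"
    using assms(2,3) by auto
  then have "max_degree G \<in> degree G ` verts G"
    unfolding max_degree_def by (intro Max_in) auto
  then obtain v where v: "v \<in> verts G" "degree G v = max_degree G"
    by auto
  obtain B where "limited_packing k G B" "card B = limited_packing_number k G"
    by (rule obtain_max_limited_packing)
  with limited_packing_card_le[OF _ v(1)] v(2) assms(2) show ?thesis
    by fastforce
qed

end
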